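(* Let $H$ be a complex Hilbert space and let $A,K\in B(H)$ be such that $A$ is positive and $(AK)^*$ is hyponormal. Then \[|\langle AKx,x\rangle|\leq \|K\|\,\langle Ax,x\rangle\] for all $x\in H$.
   Context: $B(H)$ denotes the algebra of bounded linear operators on the complex Hilbert space $H$. An operator $A\in B(H)$ is positive ($A\geq 0$) if $\langle Ax,x\rangle\geq 0$ for all $x\in H$. An operator $T\in B(H)$ is hyponormal if $TT^*\leq T^*T$, equivalently $\|T^*x\|\leq\|Tx\|$ for all $x\in H$. *)

theory Defs
  imports "HOL-Analysis.Analysis"
begin

class complex_vector = real_vector +
  fixes scaleC :: "complex \<Rightarrow> 'a \<Rightarrow> 'a" (infixr \<open>*\<^sub>C\<close> 75)
  assumes scaleC_add_right: "c *\<^sub>C (x + y) = c *\<^sub>C x + c *\<^sub>C y"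
    and scaleC_add_left: "(c + d) *\<^sub>C x = c *\<^sub>C x + d *\<^sub>C x"
    and scaleC_scaleC: "c *\<^sub>C (d *\<^sub>C x) = (c * d) *\<^sub>C x"
    and scaleC_one: "1 *\<^sub>C x = x"
    and scaleC_of_real: "complex_of_real r *\<^sub>C x = r *\<^sub>R x"

text \<open>The inner product is linear in the first and conjugate-linear in the second argument.
  Positive definiteness is contained in \<open>norm_eq_sqrt_cinner\<close>, since a norm vanishes only at \<open>0\<close>.
  Conversely, the norm axioms are a consequence of those of an inner product, so building on
  \<^class>\<open>real_normed_vector\<close> is no restriction.\<close>

class complex_inner = complex_vector + real_normed_vector +
  fixes cinner :: "'a \<Rightarrow> 'a \<Rightarrow> complex"
  assumes cinner_commute: "cinner x y = cnj (cinner y x)"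
    and cinner_add_left: "cinner (x + y) z = cinner x z + cinner y z"
    and cinner_scaleC_left: "cinner (c *\<^sub>C x) y = c * cinner x y"
    and cinner_self_nonneg: "cinner x x \<in> \<real>\<^sub>\<ge>\<^sub>0"
    and norm_eq_sqrt_cinner: "norm x = sqrt (Re (cinner x x))"

class complex_hilbert_space = complex_inner + complete_space

instantiation complex :: complex_hilbert_space
begin

definition scaleC_complex :: "complex \<Rightarrow> complex \<Rightarrow> complex"
  where "scaleC_complex c z = c * z"

definition cinner_complex :: "complex \<Rightarrow> complex \<Rightarrow> complex"
  where "cinner_complex z w = z * cnj w"

instance
  by standard
    (auto simp: scaleC_complex_def cinner_complex_def algebra_simps scaleR_conv_of_real
      complex_mult_cnj nonneg_Reals_of_real_iff cmod_def complex_nonneg_Reals_iff)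

end

text \<open>The operator norm of an element of $B(H)$ is the library's \<^const>\<open>onorm\<close>.\<close>

locale bounded_clinear = bounded_linear f
  for f :: "'a::complex_inner \<Rightarrow> 'b::complex_inner" +
  assumes scaleC: "f (c *\<^sub>C x) = c *\<^sub>C f x"

text \<open>On a complex Hilbert space every bounded operator has exactly one adjoint
  (Riesz representation), so the description below is proper for all operators in $B(H)$.\<close>

definition cadjoint ::
  "('a::complex_hilbert_space \<Rightarrow> 'a) \<Rightarrow> 'a \<Rightarrow> 'a"
  where "cadjoint T = (THE S. \<forall>x y. cinner (T x) y = cinner x (S y))"

definition positive_op :: "('a::complex_hilbert_space \<Rightarrow> 'a) \<Rightarrow> bool"
  where "positive_op A \<longleftrightarrow> (\<forall>x. cinner (A x) x \<in> \<real>\<^sub>\<ge>\<^sub>0)"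

definition le_op ::
  "('a::complex_hilbert_space \<Rightarrow> 'a) \<Rightarrow> ('a \<Rightarrow> 'a) \<Rightarrow> bool"
  where "le_op A B \<longleftrightarrow> positive_op (\<lambda>x. B x - A x)"

definition hyponormal :: "('a::complex_hilbert_space \<Rightarrow> 'a) \<Rightarrow> bool"
  where "hyponormal T \<longleftrightarrow> le_op (T \<circ> cadjoint T) (cadjoint T \<circ> T)"

end

theory Submission imports Defs begin

text \<open>Put \<open>T = A K\<close> and \<open>k = \<parallel>K\<parallel>\<close>. Hyponormality of \<open>T\<^sup>*\<close> gives
  \<open>\<parallel>T x\<parallel> \<le> \<parallel>T\<^sup>* x\<parallel> = \<parallel>K\<^sup>* A x\<parallel> \<le> k \<parallel>A x\<parallel>\<close>, so for every unimodular \<open>c\<close> the real part \<open>D\<close> of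
  \<open>c T\<close> satisfies \<open>\<parallel>D x\<parallel> \<le> \<parallel>k A x\<parallel>\<close>, that is \<open>D\<^sup>2 \<le> (k A)\<^sup>2\<close>. The square root is operator monotone, so
  \<open>D \<le> k A\<close>, and choosing \<open>c\<close> with \<open>c \<langle>T x, x\<rangle> = \<bar>\<langle>T x, x\<rangle>\<bar>\<close> yields the claim. The monotonicity
  is shown without square roots: if \<open>P - D\<close> had a negative lower bound \<open>m\<close>, then on approximate
  eigenvectors \<open>x\<close> for \<open>m\<close> we would have \<open>D x \<approx> P x - m x\<close>, which is longer than \<open>P x\<close>.\<close>

section \<open>Calculus of the real and complex inner products, Cauchy-Schwarz\<close>

abbreviation (input) rinner :: "'a::complex_inner \<Rightarrow> 'a \<Rightarrow> real"
  where "rinner x y \<equiv> Re (cinner x y)"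

lemma cinner_add_right: "cinner x (y + z) = cinner x y + cinner x z"
  by (metis cinner_add_left cinner_commute complex_cnj_add)

lemma cinner_scaleC_right: "cinner x (c *\<^sub>C y) = cnj c * cinner x y"
  by (metis cinner_commute cinner_scaleC_left complex_cnj_mult)

lemma cinner_scaleR_left: "cinner (r *\<^sub>R x) y = complex_of_real r * cinner x y"
  by (metis cinner_scaleC_left scaleC_of_real)

lemma cinner_scaleR_right: "cinner x (r *\<^sub>R y) = complex_of_real r * cinner x y"
  by (metis cinner_scaleC_right scaleC_of_real complex_cnj_complex_of_real)

lemma cinner_minus_left: "cinner (- x) y = - cinner x y"
  using cinner_scaleR_left[of "-1" x y] by simp

lemma cinner_minus_right: "cinner x (- y) = - cinner x y"
  using cinner_scaleR_right[of x "-1" y] by simp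

lemma cinner_diff_left: "cinner (x - y) z = cinner x z - cinner y z"
  using cinner_add_left[of x "- y" z] by (simp add: cinner_minus_left)

lemma cinner_diff_right: "cinner x (y - z) = cinner x y - cinner x z"
  using cinner_add_right[of x y "- z"] by (simp add: cinner_minus_right)

lemma cinner_zero_left: "cinner 0 x = 0"
  using cinner_diff_left[of 0 0 x] by simp

lemma cinner_zero_right: "cinner x 0 = 0"
  using cinner_diff_right[of x 0 0] by simp

lemmas cinner_simps = cinner_add_left cinner_add_right cinner_diff_left cinner_diff_right
  cinner_scaleR_left cinner_scaleR_right cinner_scaleC_left cinner_scaleC_right

lemma rinner_commute: "rinner x y = rinner y x"
  by (metis cinner_commute complex_cnj(1) complex.collapse complex.sel(1))

lemma rinner_self: "rinner x x = (norm x)\<^sup>2"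
  using cinner_self_nonneg[of x] by (simp add: norm_eq_sqrt_cinner complex_nonneg_Reals_iff)

lemma cinner_ext: "(\<And>x. cinner x y = cinner x z) \<Longrightarrow> y = z"
  using rinner_self[of "y - z"] by (simp add: cinner_diff_right)

lemma rinner_ext: "(\<And>x. rinner x y = rinner x z) \<Longrightarrow> y = z"
  using rinner_self[of "y - z"] by (simp add: cinner_diff_right)

text \<open>A real quadratic without negative values has no two distinct real roots. The degenerate
  case \<open>c = 0\<close> is included, so the lemma also serves semidefinite forms.\<close>

lemma discriminant_le:
  fixes a b c :: real
  assumes nonneg: "\<And>t. 0 \<le> a + 2 * t * b + t\<^sup>2 * c"
  shows "b\<^sup>2 \<le> a * c"
proof (cases "c = 0")
  case True
  have "b = 0"
  proof (rule ccontr)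
    assume "b \<noteq> 0"
    then show False
      \<comment> \<open>At this \<open>t\<close> the affine function \<open>a + 2 * t * b\<close>
        takes the value -1.\<close>
      using nonneg[of "- (a + 1) / (2 * b)"] True by (simp add: field_simps)
  qed
  then show ?thesis
    using True by simp
next
  case False
  have "0 \<le> c"
  proof (rule ccontr)
    assume "\<not> 0 \<le> c"
    then have c: "c < 0" by simp
    \<comment> \<open>Chosen so large that the negative term \<open>t\<^sup>2 * c\<close> outweighs
      the other two and the quadratic is at most -1.\<close>
    define t where "t = (1 + \<bar>a\<bar> + 2 * \<bar>b\<bar>) / - c + 1"
    have t1: "t \<ge> 1"
      using c by (simp add: t_def divide_simps)
    have "- c * t \<ge> 1 + \<bar>a\<bar> + 2 * \<bar>b\<bar>"
      using c by (simp add: t_def field_simps)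
    then have "t * (- c * t) \<ge> t * (1 + \<bar>a\<bar> + 2 * \<bar>b\<bar>)"
      using t1 by (intro mult_left_mono) auto
    moreover have "t * (1 + \<bar>a\<bar>) \<ge> 1 + \<bar>a\<bar>"
      using t1 mult_right_mono[of 1 t "1 + \<bar>a\<bar>"] by simp
    moreover have "t * b \<le> t * \<bar>b\<bar>"
      using t1 by (intro mult_left_mono) auto
    ultimately show False
      using nonneg[of t] by (simp add: algebra_simps power2_eq_square)
  qed
  with False have c: "c > 0" by simp
  have "0 \<le> a - b\<^sup>2 / c"
    \<comment> \<open>The vertex of the parabola.\<close>
    using nonneg[of "- b / c"] c by (simp add: power2_eq_square field_simps)
  then show ?thesis
    using c by (simp add: field_simps)
qed

lemma rinner_Cauchy_Schwarz: "\<bar>rinner x y\<bar> \<le> norm x * norm y"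
proof -
  have "(rinner x y)\<^sup>2 \<le> (norm x)\<^sup>2 * (norm y)\<^sup>2"
  proof (rule discriminant_le)
    fix t
    have "0 \<le> rinner (x + t *\<^sub>R y) (x + t *\<^sub>R y)"
      by (simp add: rinner_self)
    also have "\<dots> = (norm x)\<^sup>2 + 2 * t * rinner x y + t\<^sup>2 * (norm y)\<^sup>2"
      using rinner_commute[of x y]
      by (simp add: cinner_simps rinner_self algebra_simps power2_eq_square)
    finally show "0 \<le> (norm x)\<^sup>2 + 2 * t * rinner x y + t\<^sup>2 * (norm y)\<^sup>2" .
  qed
  then show ?thesis
    by (metis abs_le_square_iff abs_mult abs_norm_cancel power_mult_distrib)
qed

lemma norm_le_if_power2_le:
  fixes x :: "'a::real_normed_vector"
  assumes "0 \<le> b" "(norm x)\<^sup>2 \<le> b * norm x"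
  shows "norm x \<le> b"
  using assms by (cases "norm x = 0") (auto simp: power2_eq_square)

subsection \<open>Riesz representation and adjoints\<close>

text \<open>The representing vector is obtained as the minimizer of \<open>J\<close>: if
  \<open>y\<close> represents \<open>f\<close>, then \<open>J x\<close> is the squared distance from
  \<open>x\<close> to \<open>y\<close> minus the squared norm of \<open>y\<close>.\<close>

lemma Riesz_representation_real:
  fixes f :: "'a::complex_hilbert_space \<Rightarrow> real"
  assumes "bounded_linear f"
  obtains y where "\<And>x. f x = rinner x y"
proof -
  interpret bounded_linear f by fact
  obtain C where C: "\<And>x. norm (f x) \<le> norm x * C"
    using bounded by blast
  define J where "J x = (norm x)\<^sup>2 - 2 * f x" for x
  have J_ge: "- C\<^sup>2 \<le> J x" for x
  proof -
    have "0 \<le> (norm x - C)\<^sup>2" by simp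
    then show ?thesis
      using C[of x] by (simp add: J_def power2_eq_square algebra_simps abs_le_iff)
  qed
  define d where "d = Inf (range J)"
  have bdd: "bdd_below (range J)"
    using J_ge by (intro bdd_belowI2)
  have d_le: "d \<le> J x" for x
    unfolding d_def using bdd by (intro cInf_lower) auto
  have "\<exists>x. J x < d + inverse (real (Suc n))" for n
    using cInf_lessD[of "range J" "d + inverse (real (Suc n))"] by (auto simp: d_def)
  then obtain X where X: "\<And>n. J (X n) < d + inverse (real (Suc n))"
    by metis
  \<comment> \<open>Parallelogram law: the linear parts cancel at the midpoint \<open>z\<close>,
    where \<open>J\<close> is still at least \<open>d\<close>. Hence minimizing sequences are
    Cauchy.\<close>
  have dist_le: "(norm (x - y))\<^sup>2 \<le> 2 * (J x - d) + 2 * (J y - d)" for x y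
  proof -
    define z where "z = (1/2) *\<^sub>R (x + y)"
    have "(norm (x - y))\<^sup>2 = 2 * J x + 2 * J y - 4 * J z"
      unfolding z_def J_def rinner_self[symmetric] scaleR add
      by (simp add: cinner_simps algebra_simps)
    then show ?thesis
      using d_le[of z] by (simp add: algebra_simps)
  qed
  have "Cauchy X"
  proof (rule metric_CauchyI)
    fix e :: real assume e: "0 < e"
    then obtain N where N: "inverse (real (Suc N)) < e\<^sup>2 / 4"
      using reals_Archimedean[of "e\<^sup>2 / 4"] by auto
    have small: "J (X n) - d < e\<^sup>2 / 4" if "n \<ge> N" for n
    proof -
      have "inverse (real (Suc n)) \<le> inverse (real (Suc N))"
        using that by (simp add: le_imp_inverse_le)
      then show ?thesis
        using X[of n] N by linarith
    qed
    have "dist (X m) (X n) < e" if "m \<ge> N" "n \<ge> N" for m n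
    proof (rule power_less_imp_less_base)
      show "(dist (X m) (X n))\<^sup>2 < e\<^sup>2"
        using dist_le[of "X m" "X n"] small[OF that(1)] small[OF that(2)]
        by (simp add: dist_norm field_simps)
    qed (use e in simp)
    then show "\<exists>M. \<forall>m\<ge>M. \<forall>n\<ge>M. dist (X m) (X n) < e"
      by blast
  qed
  then obtain y where y: "X \<longlonglongrightarrow> y"
    using Cauchy_convergent convergent_def by blast
  have "(\<lambda>n. J (X n)) \<longlonglongrightarrow> J y"
    unfolding J_def by (intro tendsto_intros tendsto y)
  moreover have "(\<lambda>n. d + inverse (real (Suc n))) \<longlonglongrightarrow> d"
    using LIMSEQ_inverse_real_of_nat_add by blast
  ultimately have "J y \<le> d"
    by (rule LIMSEQ_le) (use X less_imp_le in blast)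
  have "f x = rinner x y" for x
  proof -
    \<comment> \<open>First variation at the minimizer: the constant term of the quadratic in
      \<open>t\<close> is 0, which forces the linear coefficient to vanish.\<close>
    have "(rinner x y - f x)\<^sup>2 \<le> 0 * (norm x)\<^sup>2"
    proof (rule discriminant_le)
      fix t
      have "J (y + t *\<^sub>R x) = J y + (0 + 2 * t * (rinner x y - f x) + t\<^sup>2 * (norm x)\<^sup>2)"
        unfolding J_def rinner_self[symmetric] scaleR add using rinner_commute[of x y]
        by (simp add: cinner_simps algebra_simps power2_eq_square)
      then show "0 \<le> 0 + 2 * t * (rinner x y - f x) + t\<^sup>2 * (norm x)\<^sup>2"
        using d_le[of "y + t *\<^sub>R x"] \<open>J y \<le> d\<close> by linarith
    qed
    then show ?thesis by simp
  qed
  then show ?thesis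
    by (rule that)
qed

text \<open>Replacing \<open>x\<close> by \<open>\<i> *\<^sub>C x\<close> turns equality of real
  parts into equality of imaginary parts.\<close>

lemma cinner_eq_if_rinner_eq:
  assumes "bounded_clinear T" and "\<And>x. rinner (T x) y = rinner x z"
  shows "cinner (T x) y = cinner x z"
proof -
  interpret bounded_clinear T by fact
  show ?thesis
    using assms(2)[of x] assms(2)[of "\<i> *\<^sub>C x"]
    by (simp add: scaleC cinner_scaleC_left complex_eq_iff)
qed

lemma cadjoint_eqI:
  assumes "\<And>x y. cinner (T x) y = cinner x (S y)"
  shows "cadjoint T = S"
  unfolding cadjoint_def
proof (rule the_equality)
  fix S' assume "\<forall>x y. cinner (T x) y = cinner x (S' y)"
  then show "S' = S"
    using assms by (metis cinner_ext ext)
qed (use assms in blast)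

lemma cinner_cadjoint_right:
  assumes "bounded_clinear T"
  shows "cinner (T x) y = cinner x (cadjoint T y)"
proof -
  interpret bounded_clinear T by fact
  have "\<exists>z. \<forall>x. cinner (T x) y = cinner x z" for y
  proof -
    obtain C where C: "\<And>x. norm (T x) \<le> norm x * C"
      using bounded by blast
    have "bounded_linear (\<lambda>x. rinner (T x) y)"
    proof (rule bounded_linear_intro)
      show "norm (rinner (T x) y) \<le> norm x * (C * norm y)" for x
        using rinner_Cauchy_Schwarz[of "T x" y] mult_right_mono[OF C[of x], of "norm y"]
        by (simp add: mult.assoc)
    qed (simp_all add: add scaleR cinner_simps)
    then obtain z where "\<And>x. rinner (T x) y = rinner x z"
      using Riesz_representation_real by blast
    then show ?thesis
      using cinner_eq_if_rinner_eq[OF assms] by blast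
  qed
  then obtain S where "\<And>x y. cinner (T x) y = cinner x (S y)"
    by metis
  then show ?thesis
    using cadjoint_eqI by metis
qed

text \<open>Conjugating the adjoint relation exhibits \<open>T\<close> as an adjoint of
  \<open>cadjoint T\<close>, and adjoints are unique.\<close>

lemma cadjoint_cadjoint:
  assumes "bounded_clinear T"
  shows "cadjoint (cadjoint T) = T"
  by (rule cadjoint_eqI) (metis assms cinner_cadjoint_right cinner_commute)

lemma bounded_clinear_compose:
  assumes "bounded_clinear A" "bounded_clinear K"
  shows "bounded_clinear (A \<circ> K)"
proof -
  interpret A: bounded_clinear A by fact
  interpret K: bounded_clinear K by fact
  show ?thesis
    using bounded_linear_compose[OF A.bounded_linear_axioms K.bounded_linear_axioms]
    by (simp add: bounded_clinear_def bounded_clinear_axioms_def comp_def A.scaleC K.scaleC)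
qed

text \<open>As \<open>T\<close> is the adjoint of \<open>cadjoint T\<close>, the two terms of the
  form in the hyponormality condition are the squared norms of \<open>cadjoint T x\<close> and
  \<open>T x\<close>.\<close>

lemma hyponormal_cadjoint_norm_le:
  assumes T: "bounded_clinear T" and hyp: "hyponormal (cadjoint T)"
  shows "norm (T x) \<le> norm (cadjoint T x)"
proof -
  have "rinner (T (cadjoint T x) - cadjoint T (T x)) x \<ge> 0"
    using hyp
    by (simp add: hyponormal_def le_op_def positive_op_def cadjoint_cadjoint[OF T]
        complex_nonneg_Reals_iff)
  moreover have "rinner (cadjoint T (T x)) x = (norm (T x))\<^sup>2"
    by (metis T cinner_cadjoint_right rinner_commute rinner_self)
  moreover have "rinner (T (cadjoint T x)) x = (norm (cadjoint T x))\<^sup>2"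
    by (metis T cinner_cadjoint_right rinner_self)
  ultimately show ?thesis
    by (simp add: cinner_diff_left)
qed

subsection \<open>Symmetric operators\<close>

text \<open>Symmetry refers to the underlying real inner product, since only real quadratic forms
  are compared below.\<close>

definition symmetric_op :: "('a::complex_inner \<Rightarrow> 'a) \<Rightarrow> bool"
  where "symmetric_op B \<longleftrightarrow> (\<forall>x y. rinner (B x) y = rinner x (B y))"

lemma symmetric_opD: "symmetric_op B \<Longrightarrow> rinner (B x) y = rinner x (B y)"
  by (simp add: symmetric_op_def)

lemma symmetric_op_linear:
  assumes "symmetric_op B"
  shows "linear B"
proof (rule linearI)
  show "B (x + y) = B x + B y" for x y
    by (rule rinner_ext) (simp add: cinner_simps symmetric_opD[OF assms, symmetric])
  show "B (r *\<^sub>R x) = r *\<^sub>R B x" for r x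
    by (rule rinner_ext) (simp add: cinner_simps symmetric_opD[OF assms, symmetric])
qed

text \<open>Polarization: the form of \<open>A\<close> is real at \<open>x\<close>, \<open>y\<close>
  and \<open>\<i> *\<^sub>C x + y\<close>, and the imaginary part of the mixed terms at the last
  vector is the difference of the two sides.\<close>

lemma positive_op_symmetric:
  assumes "bounded_clinear A" "positive_op A"
  shows "symmetric_op A"
  unfolding symmetric_op_def
proof (intro allI)
  fix x y
  interpret bounded_clinear A by fact
  have "Im (cinner (A z) z) = 0" for z
    using assms(2) by (simp add: positive_op_def complex_nonneg_Reals_iff)
  from this[of x] this[of y] this[of "\<i> *\<^sub>C x + y"] have "rinner (A x) y = rinner (A y) x"
    by (simp add: add scaleC cinner_simps)
  then show "rinner (A x) y = rinner x (A y)"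
    by (simp add: rinner_commute)
qed

text \<open>Cauchy-Schwarz for the semi-inner product induced by \<open>E\<close>, applied to
  \<open>x\<close> and \<open>E x\<close>. It shows that \<open>E x\<close> is small wherever the
  form of \<open>E\<close> is small.\<close>

lemma positive_symmetric_norm_le:
  assumes sym: "symmetric_op E" and pos: "\<And>x. 0 \<le> rinner (E x) x"
    and bound: "\<And>x. norm (E x) \<le> M * norm x"
  shows "(norm (E x))\<^sup>2 \<le> M * rinner (E x) x"
proof -
  interpret linear E by (rule symmetric_op_linear[OF sym])
  have CS: "(rinner (E x) y)\<^sup>2 \<le> rinner (E x) x * rinner (E y) y" for x y
  proof (rule discriminant_le)
    fix t
    have "rinner (E (x + t *\<^sub>R y)) (x + t *\<^sub>R y)
        = rinner (E x) x + 2 * t * rinner (E x) y + t\<^sup>2 * rinner (E y) y"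
      using symmetric_opD[OF sym, of x y] rinner_commute[of x "E y"]
      by (simp add: add scale cinner_simps algebra_simps power2_eq_square)
    then show "0 \<le> rinner (E x) x + 2 * t * rinner (E x) y + t\<^sup>2 * rinner (E y) y"
      using pos by metis
  qed
  have "((norm (E x))\<^sup>2)\<^sup>2 \<le> rinner (E x) x * rinner (E (E x)) (E x)"
    using CS[of x "E x"] by (simp add: rinner_self)
  also have "\<dots> \<le> rinner (E x) x * (M * (norm (E x))\<^sup>2)"
  proof (rule mult_left_mono[OF _ pos])
    have "rinner (E (E x)) (E x) \<le> norm (E (E x)) * norm (E x)"
      using rinner_Cauchy_Schwarz abs_le_D1 by blast
    also have "\<dots> \<le> M * norm (E x) * norm (E x)"
      by (intro mult_right_mono bound) simp
    finally show "rinner (E (E x)) (E x) \<le> M * (norm (E x))\<^sup>2"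
      by (simp add: power2_eq_square)
  qed
  finally have *: "(norm (E x))\<^sup>2 * (norm (E x))\<^sup>2 \<le> M * rinner (E x) x * (norm (E x))\<^sup>2"
    by (simp add: power2_eq_square mult_ac)
  show ?thesis
  proof (cases "E x = 0")
    case False
    then show ?thesis
      using mult_right_le_imp_le[OF *] by simp
  qed (simp add: cinner_zero_left)
qed

text \<open>The approximate eigenvector argument in quantitative form: if the infimum
  \<open>m\<close> of the form of \<open>P - D\<close> on the unit sphere were negative,
  \<open>E = P - D - m\<close> would be bounded below in norm there, hence also in its form, and
  \<open>m\<close> could be raised.\<close>

lemma symmetric_op_dominated:
  assumes P: "symmetric_op P" "\<And>x. norm (P x) \<le> p * norm x" "\<And>x. 0 \<le> rinner (P x) x"
    and D: "symmetric_op D" "\<And>x. norm (D x) \<le> norm (P x)"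
  shows "rinner (D x) x \<le> rinner (P x) x"
proof (rule ccontr)
  assume neg: "\<not> rinner (D x) x \<le> rinner (P x) x"
  define B where "B y = P y - D y" for y
  define m where "m = (INF y\<in>{y. norm y = 1}. rinner (B y) y)"
  define E where "E y = B y - m *\<^sub>R y" for y
  \<comment> \<open>\<open>M\<close> bounds the operator \<open>E\<close>; \<open>q\<close> bounds
    the vector \<open>2 *\<^sub>R P y - (2 * m) *\<^sub>R y\<close> for unit
    \<open>y\<close>.\<close>
  define M where "M = 2 * \<bar>p\<bar> + \<bar>m\<bar>"
  define q where "q = 2 * \<bar>p\<bar> + 2 * \<bar>m\<bar>"
  have B_scale: "B (r *\<^sub>R y) = r *\<^sub>R B y" for r y
    using linear_scale[OF symmetric_op_linear[OF P(1)]] linear_scale[OF symmetric_op_linear[OF D(1)]]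
    by (simp add: B_def scaleR_diff_right)
  have P_le: "norm (P y) \<le> \<bar>p\<bar> * norm y" for y
    by (rule order_trans[OF P(2) mult_right_mono]) auto
  have B_le: "norm (B y) \<le> 2 * \<bar>p\<bar> * norm y" for y
    using norm_triangle_ineq4[of "P y" "D y"] P_le[of y] D(2)[of y] by (simp add: B_def)
  have bdd: "bdd_below ((\<lambda>y. rinner (B y) y) ` {y. norm y = 1})"
  proof (rule bdd_belowI2)
    fix y :: 'a assume "y \<in> {y. norm y = 1}"
    then show "- (2 * \<bar>p\<bar>) \<le> rinner (B y) y"
      using rinner_Cauchy_Schwarz[of "B y" y] B_le[of y] by (simp add: abs_le_iff)
  qed
  have m_le: "m \<le> rinner (B y) y" if "norm y = 1" for y
    unfolding m_def using that by (intro cINF_lower[OF bdd]) simp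
  have m_le': "m * (norm y)\<^sup>2 \<le> rinner (B y) y" for y
  proof (cases "y = 0")
    case False
    then show ?thesis
      using m_le[of "(1 / norm y) *\<^sub>R y"]
      by (simp add: B_scale cinner_simps field_simps power2_eq_square)
  qed (simp add: cinner_zero_right)
  have x: "norm x \<noteq> 0"
    using neg by (auto simp: cinner_zero_right)
  have "m * (norm x)\<^sup>2 < 0"
    using m_le'[of x] neg by (simp add: B_def cinner_diff_left)
  then have m: "m < 0"
    by (simp add: mult_less_0_iff)
  have E_sym: "symmetric_op E"
    using P(1) D(1) by (simp add: symmetric_op_def E_def B_def cinner_simps)
  have E_pos: "0 \<le> rinner (E y) y" for y
    using m_le'[of y] by (simp add: E_def cinner_simps rinner_self)
  have E_le: "norm (E y) \<le> M * norm y" for y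
    using norm_triangle_ineq4[of "B y" "m *\<^sub>R y"] B_le[of y]
    by (simp add: E_def M_def algebra_simps)
  have E_ge: "m\<^sup>2 \<le> q * norm (E y)" if y: "norm y = 1" for y
  proof -
    have "(norm (D y))\<^sup>2 \<le> (norm (P y))\<^sup>2"
      using D(2) by (intro power_mono) auto
    moreover have "D y = P y - E y - m *\<^sub>R y"
      by (simp add: E_def B_def)
    moreover have "rinner y y = 1"
      using y by (simp add: rinner_self)
    \<comment> \<open>Expansion of the squared norm of \<open>P y - E y - m *\<^sub>R y\<close>,
      with the squared norm of \<open>P y\<close> cancelled. Since \<open>m < 0\<close> and
      \<open>P\<close> is positive, the left side is at least \<open>m\<^sup>2\<close>.\<close>
    ultimately have "m\<^sup>2 + rinner (E y) (E y) - 2 * m * rinner (P y) y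
        \<le> rinner (E y) (2 *\<^sub>R P y - (2 * m) *\<^sub>R y)"
      using rinner_commute[of y "E y"] rinner_commute[of "P y" "E y"] rinner_commute[of y "P y"]
      unfolding rinner_self[symmetric]
      by (simp add: cinner_simps algebra_simps power2_eq_square)
    moreover have "2 * m * rinner (P y) y \<le> 0"
      using m P(3)[of y] by (simp add: mult_nonpos_nonneg)
    moreover have "0 \<le> rinner (E y) (E y)"
      by (simp add: rinner_self)
    moreover have "rinner (E y) (2 *\<^sub>R P y - (2 * m) *\<^sub>R y)
        \<le> norm (E y) * norm (2 *\<^sub>R P y - (2 * m) *\<^sub>R y)"
      using rinner_Cauchy_Schwarz abs_le_D1 by blast
    moreover have "norm (2 *\<^sub>R P y - (2 * m) *\<^sub>R y) \<le> q"
      using norm_triangle_ineq4[of "2 *\<^sub>R P y" "(2 * m) *\<^sub>R y"] P_le[of y] y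
      by (simp add: q_def abs_mult)
    then have "norm (E y) * norm (2 *\<^sub>R P y - (2 * m) *\<^sub>R y) \<le> q * norm (E y)"
      unfolding mult.commute[of q] by (rule mult_left_mono) simp
    ultimately show ?thesis
      by linarith
  qed
  \<comment> \<open>The lower bound \<open>m\<^sup>2 / q\<close> for the norm of \<open>E y\<close>,
    turned into one for the form of \<open>E\<close> by
    \<open>positive_symmetric_norm_le\<close>.\<close>
  define \<eta> where "\<eta> = (m\<^sup>2 / q)\<^sup>2 / M"
  have qM: "q > 0" "M > 0"
    using m by (auto simp: q_def M_def)
  have \<eta>: "\<eta> > 0"
    using m qM by (simp add: \<eta>_def)
  have "m + \<eta> \<le> rinner (B y) y" if y: "norm y = 1" for y
  proof -
    have "m\<^sup>2 / q \<le> norm (E y)"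
      using E_ge[OF y] qM by (simp add: field_simps)
    then have "(m\<^sup>2 / q)\<^sup>2 \<le> (norm (E y))\<^sup>2"
      using qM by (intro power_mono) auto
    also have "\<dots> \<le> M * rinner (E y) y"
      by (rule positive_symmetric_norm_le[OF E_sym E_pos E_le])
    finally have "\<eta> \<le> rinner (E y) y"
      using qM by (simp add: \<eta>_def divide_le_eq mult.commute)
    then show ?thesis
      using y by (simp add: E_def cinner_simps rinner_self)
  qed
  moreover have "{y::'a. norm y = 1} \<noteq> {}"
    using x by (auto intro!: exI[of _ "(1 / norm x) *\<^sub>R x"])
  ultimately have "m + \<eta> \<le> (INF y\<in>{y. norm y = 1}. rinner (B y) y)"
    by (intro cINF_greatest) auto
  then have "m + \<eta> \<le> m"
    by (simp only: m_def)
  then show False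
    using \<eta> by simp
qed

section \<open>Rotation by a phase and comparison of the real part of \<open>c T\<close> with
  \<open>k A\<close>\<close>

lemma exists_unimodular_phase: "\<exists>c. cmod c = 1 \<and> c * z = complex_of_real (cmod z)"
proof (cases "z = 0")
  case False
  then show ?thesis
    by (intro exI[of _ "cnj z / complex_of_real (cmod z)"])
      (simp add: norm_divide complex_norm_square[symmetric] power2_eq_square mult.commute)
qed (auto intro: exI[of _ 1])

theorem theorem2p1:
  fixes A K :: "'h::complex_hilbert_space \<Rightarrow> 'h"
  assumes "bounded_clinear A" and "bounded_clinear K"
    and "positive_op A"
    and "hyponormal (cadjoint (A \<circ> K))"
  shows "\<forall>x. cmod (cinner (A (K x)) x) \<le> onorm K * Re (cinner (A x) x)"
proof
  fix x
  interpret A: bounded_clinear A by fact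
  interpret K: bounded_clinear K by fact
  define T where "T = A \<circ> K"
  define S where "S = cadjoint T"
  define k where "k = onorm K"
  have T: "bounded_clinear T"
    unfolding T_def by (rule bounded_clinear_compose[OF assms(1,2)])
  have adj: "cinner (T y) z = cinner y (S z)" for y z
    unfolding S_def by (rule cinner_cadjoint_right[OF T])
  have A_sym: "symmetric_op A"
    by (rule positive_op_symmetric[OF assms(1,3)])
  have k: "0 \<le> k" "norm (K y) \<le> k * norm y" for y
    unfolding k_def by (rule onorm_pos_le onorm, rule K.bounded_linear_axioms)+
  have S_le: "norm (S y) \<le> k * norm (A y)" for y
  proof (rule norm_le_if_power2_le)
    \<comment> \<open>The bound for \<open>S = K\<^sup>* A\<close> is read off from
      \<open>T (S y) = A (K (S y))\<close> by moving \<open>A\<close> across, so the adjoint of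
      \<open>K\<close> never appears.\<close>
    have "(norm (S y))\<^sup>2 = rinner (K (S y)) (A y)"
      by (metis T_def adj comp_apply rinner_self symmetric_opD[OF A_sym])
    also have "\<dots> \<le> norm (K (S y)) * norm (A y)"
      using rinner_Cauchy_Schwarz abs_le_D1 by blast
    also have "\<dots> \<le> k * norm (S y) * norm (A y)"
      by (intro mult_right_mono k) simp
    finally show "(norm (S y))\<^sup>2 \<le> k * norm (A y) * norm (S y)"
      by (simp add: mult_ac)
  qed (use k in simp)
  have T_le: "norm (T y) \<le> norm (S y)" for y
    unfolding S_def using hyponormal_cadjoint_norm_le[OF T] assms(4) by (simp add: T_def)
  obtain c where c: "cmod c = 1"
    "c * cinner (T x) x = complex_of_real (cmod (cinner (T x) x))"
    using exists_unimodular_phase by blast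
  have norm_c: "norm (b *\<^sub>C y) = norm y" if "cmod b = 1" for b and y :: 'h
  proof -
    have "cinner (b *\<^sub>C y) (b *\<^sub>C y) = b * cnj b * cinner y y"
      by (simp add: cinner_simps)
    then show ?thesis
      using that by (simp add: norm_eq_sqrt_cinner complex_norm_square[symmetric])
  qed
  define P where "P y = k *\<^sub>R A y" for y
  \<comment> \<open>The real part of \<open>c T\<close>. Its norm at \<open>y\<close> is at most the
    mean of those of \<open>T y\<close> and \<open>S y\<close>, and its form at \<open>x\<close> is
    the real part of \<open>c * cinner (T x) x\<close>.\<close>
  define D where "D y = (1/2) *\<^sub>R (c *\<^sub>C T y + cnj c *\<^sub>C S y)" for y
  have adj': "cinner (S y) z = cinner y (T z)" for y z
    by (metis adj cinner_commute)
  have "rinner (D x) x \<le> rinner (P x) x"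
  proof (rule symmetric_op_dominated)
    show "symmetric_op P"
      using A_sym by (simp add: symmetric_op_def P_def cinner_simps)
    show "norm (P y) \<le> k * onorm A * norm y" for y
      using mult_left_mono[OF onorm[OF A.bounded_linear_axioms, of y] k(1)] k(1)
      by (simp add: P_def mult.assoc)
    show "0 \<le> rinner (P y) y" for y
      using assms(3) k(1) by (simp add: P_def cinner_simps positive_op_def complex_nonneg_Reals_iff)
    show "symmetric_op D"
      by (simp add: symmetric_op_def D_def cinner_simps adj adj')
    show "norm (D y) \<le> norm (P y)" for y
      using norm_triangle_ineq[of "c *\<^sub>C T y" "cnj c *\<^sub>C S y"] c(1) T_le[of y] S_le[of y] k(1)
      by (simp add: D_def P_def norm_c)
  qed
  moreover have "rinner (D x) x = cmod (cinner (T x) x)"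
  proof -
    have "cinner (S x) x = cnj (cinner (T x) x)"
      by (metis adj' cinner_commute)
    then have "cinner (D x) x
        = (c * cinner (T x) x + cnj (c * cinner (T x) x)) / 2"
      by (simp add: D_def cinner_simps)
    then show ?thesis
      by (simp add: c(2))
  qed
  ultimately show "cmod (cinner (A (K x)) x) \<le> onorm K * Re (cinner (A x) x)"
    by (simp add: P_def cinner_simps T_def k_def)
qed

end
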